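(* There exists a quantum algorithm that can find a collision in an arbitrary $r$-to-one function $F:X\to Y$ ($X$ finite, $F$ given as a black box), for any integer $r\ge 2$, using space $S$ and an expected number of $O(T)$ evaluations of $F$, for every $1\le S\le T$ subject to $$S\,T^2\ge |F(X)|,$$ where $F(X)$ denotes the image of $F$. The constant implied by $O$ is absolute.
   Context: A function $F$ is $r$-to-one if every element of its image has exactly $r$ distinct preimages. A collision of $F:X\to Y$ is a pair of distinct elements $x_0,x_1\in X$ with $F(x_0)=F(x_1)$. Model: $F$ is given as a black box (oracle), so the only way to obtain knowledge about it is to evaluate it at points of its domain. A quantum algorithm may evaluate $F$ in superposition (standard quantum query model), and the cost measure is the number of evaluations of $F$. Space is measured with a pair $(x,F(x))$ as the unit, and refers to the memory needed to hold a table of such pairs (stored evaluations of $F$). $S$ and $T$ are integers. Known search subroutine: the generalization of Grover's quantum search algorithm, for $H:X\to\{0,1\}$ with $N=|X|$ and $t=|\{x\in X: H(x)=1\}|\ge 1$, finds an $x\in X$ with $H(x)=1$ after an expected number of $O(\sqrt{N/t})$ evaluations of $H$. *)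

theory Defs
  imports "HOL-Probability.Probability"
begin

definition r_to_one :: "nat \<Rightarrow> ('x \<Rightarrow> 'y) \<Rightarrow> bool" where
  "r_to_one r F \<longleftrightarrow> (\<forall>y\<in>range F. card (F -` {y}) = r)"

definition is_collision :: "('x \<Rightarrow> 'y) \<Rightarrow> 'x \<Rightarrow> 'x \<Rightarrow> bool" where
  "is_collision F x0 x1 \<longleftrightarrow> x0 \<noteq> x1 \<and> F x0 = F x1"

text \<open>
  Pure states of a register with basis labels in \<open>'b\<close> are finitely supported amplitude functions of
  squared norm 1. The type \<open>'b\<close> may be infinite (the codomain of \<open>F\<close> is not assumed finite). If
  \<open>'b\<close> is finite, \<open>is_unitary\<close> is ordinary unitarity; otherwise it describes the unitary operators
  on \<open>\<ell>\<^sup>2\<close> that restrict to a bijection of the finitely supported vectors.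
\<close>

definition fin_supp :: "('b \<Rightarrow> complex) set" where
  "fin_supp = {\<psi>. finite {b. \<psi> b \<noteq> 0}}"

definition sq_norm :: "('b \<Rightarrow> complex) \<Rightarrow> real" where
  "sq_norm \<psi> = (\<Sum>b | \<psi> b \<noteq> 0. (cmod (\<psi> b))\<^sup>2)"

definition is_unitary :: "(('b \<Rightarrow> complex) \<Rightarrow> ('b \<Rightarrow> complex)) \<Rightarrow> bool" where
  "is_unitary U \<longleftrightarrow>
     bij_betw U fin_supp fin_supp \<and>
     (\<forall>\<phi>\<in>fin_supp. \<forall>\<psi>\<in>fin_supp. \<forall>a c.
        U (\<lambda>b. a * \<phi> b + c * \<psi> b) = (\<lambda>b. a * U \<phi> b + c * U \<psi> b)) \<and>
     (\<forall>\<psi>\<in>fin_supp. sq_norm (U \<psi>) = sq_norm \<psi>)"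

definition ket :: "'b \<Rightarrow> 'b \<Rightarrow> complex" where
  "ket b = (\<lambda>b'. if b' = b then 1 else 0)"

text \<open>Measurement in the computational basis; meant for states of squared norm 1.\<close>

definition measure_basis :: "('b \<Rightarrow> complex) \<Rightarrow> 'b pmf" where
  "measure_basis \<psi> = embed_pmf (\<lambda>b. (cmod (\<psi> b))\<^sup>2)"

text \<open>
  The standard query operator, \<open>|x, y\<rangle> \<mapsto> |x, y + F x\<rangle>\<close>. The values of \<open>F\<close> are labelled by elements
  of an arbitrary abelian group (for instance bit strings with bitwise exclusive or).
\<close>

definition query_op ::
  "('x \<Rightarrow> 'y::ab_group_add) \<Rightarrow> ('x \<times> 'y \<Rightarrow> complex) \<Rightarrow> ('x \<times> 'y \<Rightarrow> complex)" where
  "query_op F \<psi> = (\<lambda>(x, y). \<psi> (x, y - F x))"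

text \<open>
  Quantum query algorithms with bounded storage. The memory consists of a table of stored
  evaluations \<open>(x, F x)\<close> and one query register with basis states \<open>|x, y\<rangle>\<close>. Apart from the table
  there is nothing in which information about \<open>F\<close> can be kept beyond that one register: the
  instruction performed at each time step does not depend on \<open>F\<close> or on the past of the
  computation, there is no other workspace, and after each measurement the register is reset to a
  state \<open>|x, 0\<rangle>\<close>. Unitary operators and the processing of measurement outcomes may be controlled by
  the table. All randomness comes from measurements.
\<close>

datatype ('x, 'y) decision =
    Go "('x \<times> 'y) list" 'x    \<comment> \<open>new table, and the \<open>x\<close> for which the register is reset to \<open>|x, 0\<rangle>\<close>\<close>
  | Stop 'x 'x

datatype ('x, 'y) instr =
    Query
  | Apply "('x \<times> 'y) list \<Rightarrow> ('x \<times> 'y \<Rightarrow> complex) \<Rightarrow> ('x \<times> 'y \<Rightarrow> complex)"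
  | Measure "('x \<times> 'y) list \<Rightarrow> 'x \<times> 'y \<Rightarrow> ('x, 'y) decision"

record ('x, 'y) algorithm =
  start :: 'x
  program :: "nat \<Rightarrow> ('x, 'y) instr"

definition valid_algorithm :: "('x, 'y) algorithm \<Rightarrow> bool" where
  "valid_algorithm A \<longleftrightarrow> (\<forall>n U. program A n = Apply U \<longrightarrow> (\<forall>L. is_unitary (U L)))"

text \<open>In a configuration, \<open>queries\<close> counts the evaluations of \<open>F\<close> made so far.\<close>

datatype ('x, 'y) config =
    Running "('x \<times> 'y) list" "'x \<times> 'y \<Rightarrow> complex" (queries: nat)
  | Halted 'x 'x (queries: nat)

fun step ::
  "('x \<Rightarrow> 'y::ab_group_add) \<Rightarrow> ('x, 'y) instr \<Rightarrow> ('x, 'y) config \<Rightarrow> ('x, 'y) config pmf" where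
  "step F i (Halted x0 x1 q) = return_pmf (Halted x0 x1 q)"
| "step F Query (Running L \<psi> q) = return_pmf (Running L (query_op F \<psi>) (Suc q))"
| "step F (Apply U) (Running L \<psi> q) = return_pmf (Running L (U L \<psi>) q)"
| "step F (Measure f) (Running L \<psi> q) =
     map_pmf (\<lambda>b. case f L b of
                    Go L' x \<Rightarrow> Running L' (ket (x, 0)) q
                  | Stop x0 x1 \<Rightarrow> Halted x0 x1 q)
       (measure_basis \<psi>)"

fun run ::
  "('x, 'y::ab_group_add) algorithm \<Rightarrow> ('x \<Rightarrow> 'y) \<Rightarrow> nat \<Rightarrow> ('x, 'y) config pmf" where
  "run A F 0 = return_pmf (Running [] (ket (start A, 0)) 0)"
| "run A F (Suc n) = bind_pmf (run A F n) (step F (program A n))"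

text \<open>
  The unit of space is one pair \<open>(x, F x)\<close>: the table never contains anything but true evaluations
  of \<open>F\<close>, and never more than \<open>S\<close> of them, whatever the function \<open>F\<close> is.
\<close>

definition uses_space :: "('x, 'y::ab_group_add) algorithm \<Rightarrow> nat \<Rightarrow> bool" where
  "uses_space A S \<longleftrightarrow>
     (\<forall>F n L \<psi> q. Running L \<psi> q \<in> set_pmf (run A F n) \<longrightarrow>
        length L \<le> S \<and> (\<forall>(x, y)\<in>set L. y = F x))"

text \<open>With probability 1 the algorithm halts and its output is a collision.\<close>

definition finds_collision :: "('x, 'y::ab_group_add) algorithm \<Rightarrow> ('x \<Rightarrow> 'y) \<Rightarrow> bool" where
  "finds_collision A F \<longleftrightarrow>
     (\<lambda>n. measure_pmf.prob (run A F n) {Halted x0 x1 q | x0 x1 q. is_collision F x0 x1})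
       \<longlonglongrightarrow> 1"

text \<open>
  The number of evaluations made within \<open>n\<close> steps is nondecreasing in \<open>n\<close>, so by monotone
  convergence the supremum is the expected total number of evaluations.
\<close>

definition expected_queries :: "('x, 'y::ab_group_add) algorithm \<Rightarrow> ('x \<Rightarrow> 'y) \<Rightarrow> ennreal" where
  "expected_queries A F = (SUP n. \<integral>\<^sup>+ c. of_nat (queries c) \<partial>measure_pmf (run A F n))"

text \<open>
  The constant in the \<open>O\<close>-bound. A closed term is used because a constant quantified existentially
  inside a statement about type variables could depend on those types, in particular on the size
  of the domain of \<open>F\<close>, and would not be absolute. The value is a generous one.
\<close>

definition query_const :: nat where
  "query_const = 100"

end

theory Submission
  imports Defs
begin

text \<open>
  Fill the table with \<open>S\<close> evaluations of \<open>F\<close>. If they contain no collision, their values are distinct,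
  and exactly \<open>t = (r - 1) S\<close> of the \<open>N = r |F(X)|\<close> points of \<open>X\<close> lie outside the table and collide with
  an entry, so that \<open>N / t \<le> 2 |F(X)| / S \<le> 2 T\<^sup>2\<close>. Put \<open>sin\<^sup>2 \<theta> = t / N\<close>; then \<open>\<theta> \<ge> 1 / (2 T)\<close>, but \<open>\<theta>\<close> is unknown
  because \<open>r\<close> and \<open>|F(X)|\<close> are. As the schedule of queries may not depend on measurement
  outcomes, the number of Grover iterations is not drawn at random; instead it runs through
  \<open>(3\<^sup>k - 1) / 2\<close> for \<open>k = 0, \<dots>, K\<close> with \<open>2 T \<le> 3\<^sup>K \<le> 6 T\<close>. Trial \<open>k\<close> makes \<open>3\<^sup>k\<close> queries and succeeds
  with probability \<open>sin\<^sup>2 (3\<^sup>k \<theta>)\<close>, and for the first \<open>k\<close> with \<open>3\<^sup>k \<theta> \<ge> \<pi> / 4\<close> this is at least 1/2 since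
  \<open>3\<^sup>k \<theta> \<le> 3 \<pi> / 4\<close>. A round of all trials thus costs \<open>O(T)\<close> queries and succeeds with probability at
  least 1/2; rounds are repeated for ever.
\<close>

section \<open>Unitary operators\<close>

text \<open>Every unitary operator used below is its own inverse, so closure of
  \<open>fin_supp\<close> already yields bijectivity.\<close>

lemma is_unitary_involution:
  assumes closed: "\<And>\<psi>. \<psi> \<in> fin_supp \<Longrightarrow> U \<psi> \<in> fin_supp"
    and invol: "\<And>\<psi>. U (U \<psi>) = \<psi>"
    and lin: "\<And>\<phi> \<psi> a c. U (\<lambda>b. a * \<phi> b + c * \<psi> b) = (\<lambda>b. a * U \<phi> b + c * U \<psi> b)"
    and norm: "\<And>\<psi>. \<psi> \<in> fin_supp \<Longrightarrow> sq_norm (U \<psi>) = sq_norm \<psi>"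
  shows "is_unitary U"
proof -
  have "bij_betw U fin_supp fin_supp"
    by (rule bij_betw_byWitness[where f' = U]) (use closed invol in auto)
  then show ?thesis
    unfolding is_unitary_def using lin norm by auto
qed

lemma sq_norm_eq_sum:
  assumes "finite B" and "\<And>b. \<psi> b \<noteq> 0 \<Longrightarrow> b \<in> B"
  shows "sq_norm \<psi> = (\<Sum>b\<in>B. (cmod (\<psi> b))\<^sup>2)"
  unfolding sq_norm_def by (rule sum.mono_neutral_left) (use assms in auto)

definition negate_value :: "('x \<times> 'y::ab_group_add \<Rightarrow> complex) \<Rightarrow> ('x \<times> 'y \<Rightarrow> complex)" where
  "negate_value \<psi> = (\<lambda>(x, y). \<psi> (x, - y))"

text \<open>Phase oracle, meant for a register that holds |x, F x>. Points of the table are excluded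
  because they match their own entry without giving a collision.\<close>

definition flip_marked ::
  "('x \<times> 'y) list \<Rightarrow> ('x \<times> 'y \<Rightarrow> complex) \<Rightarrow> ('x \<times> 'y \<Rightarrow> complex)" where
  "flip_marked L \<psi> =
     (\<lambda>(x, y). if x \<notin> fst ` set L \<and> y \<in> snd ` set L then - \<psi> (x, y) else \<psi> (x, y))"

text \<open>For nonzero \<open>w\<close> and each fixed y this is 2 P - I, with P the orthogonal
  projection onto the line spanned by \<open>w\<close>; the division replaces a normalization of
  \<open>w\<close>. Constant weight 1 gives Grover's inversion about the mean.\<close>

definition reflect ::
  "('x::finite \<Rightarrow> real) \<Rightarrow> ('x \<times> 'y \<Rightarrow> complex) \<Rightarrow> ('x \<times> 'y \<Rightarrow> complex)" where
  "reflect w \<psi> = (\<lambda>(x, y).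
     2 * of_real (w x) * (\<Sum>x'\<in>UNIV. of_real (w x') * \<psi> (x', y)) / of_real (\<Sum>x'\<in>UNIV. (w x')\<^sup>2)
       - \<psi> (x, y))"

lemma is_unitary_negate_value: "is_unitary negate_value"
proof (rule is_unitary_involution)
  fix \<psi> :: "'a \<times> 'b \<Rightarrow> complex"
  let ?n = "\<lambda>(x::'a, y::'b). (x, - y)"
  have inj: "inj_on ?n A" for A by (auto simp: inj_on_def)
  have supp: "{b. negate_value \<psi> b \<noteq> 0} = ?n ` {b. \<psi> b \<noteq> 0}"
    by (force simp: negate_value_def image_iff)
  assume "\<psi> \<in> fin_supp"
  then show "negate_value \<psi> \<in> fin_supp"
    by (simp add: fin_supp_def supp)
  show "sq_norm (negate_value \<psi>) = sq_norm \<psi>"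
    unfolding sq_norm_def supp sum.reindex[OF inj]
    by (rule sum.cong) (auto simp: negate_value_def)
qed (auto simp: negate_value_def fun_eq_iff)

lemma is_unitary_flip_marked: "is_unitary (flip_marked L)"
proof (rule is_unitary_involution)
  fix \<psi> :: "'a \<times> 'b \<Rightarrow> complex"
  have supp: "{b. flip_marked L \<psi> b \<noteq> 0} = {b. \<psi> b \<noteq> 0}"
    by (auto simp: flip_marked_def split: if_splits)
  assume "\<psi> \<in> fin_supp"
  then show "flip_marked L \<psi> \<in> fin_supp"
    by (simp add: fin_supp_def supp)
  show "sq_norm (flip_marked L \<psi>) = sq_norm \<psi>"
    unfolding sq_norm_def supp by (rule sum.cong) (auto simp: flip_marked_def)
qed (auto simp: flip_marked_def fun_eq_iff)

lemma reflect_sum_cmod: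
  fixes w :: "'x::finite \<Rightarrow> real"
  assumes W: "(\<Sum>x\<in>UNIV. (w x)\<^sup>2) \<noteq> 0"
  shows "(\<Sum>x\<in>UNIV. (cmod (reflect w \<psi> (x, y)))\<^sup>2) = (\<Sum>x\<in>UNIV. (cmod (\<psi> (x, y)))\<^sup>2)"
proof -
  define W' where "W' = (\<Sum>x\<in>UNIV. (w x)\<^sup>2)"
  define c where "c = (\<Sum>x\<in>UNIV. of_real (w x) * \<psi> (x, y))"
  have cc: "cnj c = (\<Sum>x\<in>UNIV. of_real (w x) * cnj (\<psi> (x, y)))"
    by (simp add: c_def)
  have "W' \<noteq> 0" using W by (simp add: W'_def)
  then have W0: "complex_of_real W' \<noteq> 0" by (simp only: of_real_eq_0_iff not_False_eq_True)
  have W2: "(\<Sum>x\<in>UNIV. (complex_of_real (w x))\<^sup>2) = of_real W'"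
    by (simp add: W'_def)
  have r: "reflect w \<psi> (x, y) = 2 * of_real (w x) * c / of_real W' - \<psi> (x, y)" for x
    by (simp add: reflect_def c_def W'_def)
  have "complex_of_real (\<Sum>x\<in>UNIV. (cmod (reflect w \<psi> (x, y)))\<^sup>2)
      = (\<Sum>x\<in>UNIV. reflect w \<psi> (x, y) * cnj (reflect w \<psi> (x, y)))"
    by (simp add: complex_norm_square del: of_real_power)
  also have "\<dots> = (\<Sum>x\<in>UNIV. (4 * c * cnj c / (of_real W')\<^sup>2) * (of_real (w x))\<^sup>2
        - (2 * c / of_real W') * (of_real (w x) * cnj (\<psi> (x, y)))
        - (2 * cnj c / of_real W') * (of_real (w x) * \<psi> (x, y))
        + \<psi> (x, y) * cnj (\<psi> (x, y)))"
    by (rule sum.cong) (use W0 in \<open>auto simp: r field_simps power2_eq_square\<close>)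
  also have "\<dots> = (4 * c * cnj c / (of_real W')\<^sup>2) * of_real W'
        - (2 * c / of_real W') * cnj c - (2 * cnj c / of_real W') * c
        + (\<Sum>x\<in>UNIV. \<psi> (x, y) * cnj (\<psi> (x, y)))"
    unfolding sum.distrib sum_subtractf sum_distrib_left[symmetric] W2 cc[symmetric] c_def[symmetric] ..
  \<comment> \<open>The quadratic term 4 |c|^2 / \<open>W'\<close> cancels the two cross terms, each
    equal to 2 |c|^2 / \<open>W'\<close>.\<close>
  also have "\<dots> = (\<Sum>x\<in>UNIV. \<psi> (x, y) * cnj (\<psi> (x, y)))"
    using W0 by (simp add: field_simps power2_eq_square)
  also have "\<dots> = complex_of_real (\<Sum>x\<in>UNIV. (cmod (\<psi> (x, y)))\<^sup>2)"
    by (simp add: complex_norm_square del: of_real_power)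
  finally show ?thesis by (simp only: of_real_eq_iff)
qed

lemma is_unitary_reflect:
  fixes w :: "'x::finite \<Rightarrow> real"
  assumes W: "(\<Sum>x\<in>UNIV. (w x)\<^sup>2) \<noteq> 0"
  shows "is_unitary (reflect w :: ('x \<times> 'y \<Rightarrow> complex) \<Rightarrow> _)"
proof (rule is_unitary_involution)
  fix \<psi> :: "'x \<times> 'y \<Rightarrow> complex"
  \<comment> \<open>The type \<open>'y\<close> may be infinite, but a reflection mixes only basis
    states with the same value, so the supports before and after both lie over
    \<open>Y\<close>.\<close>
  define Y where "Y = snd ` {b. \<psi> b \<noteq> 0}"
  assume "\<psi> \<in> fin_supp"
  then have fin: "finite (UNIV \<times> Y :: ('x \<times> 'y) set)"
    by (auto simp: fin_supp_def Y_def)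
  have supp: "\<psi> b \<noteq> 0 \<Longrightarrow> b \<in> UNIV \<times> Y" for b
    by (auto simp: Y_def mem_Times_iff)
  have supp': "b \<in> UNIV \<times> Y" if "reflect w \<psi> b \<noteq> 0" for b
  proof (rule ccontr)
    obtain x y where b: "b = (x, y)" by (cases b)
    assume "b \<notin> UNIV \<times> Y"
    then have "\<psi> (x', y) = 0" for x' using supp[of "(x', y)"] b by auto
    then show False using that b by (simp add: reflect_def)
  qed
  have "{b. reflect w \<psi> b \<noteq> 0} \<subseteq> UNIV \<times> Y" using supp' by blast
  then show "reflect w \<psi> \<in> fin_supp"
    unfolding fin_supp_def using finite_subset[OF _ fin] by simp
  have swap: "(\<Sum>b\<in>UNIV \<times> Y. h b) = (\<Sum>y\<in>Y. \<Sum>x\<in>UNIV. h (x, y))" for h :: "'x \<times> 'y \<Rightarrow> real"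
    by (subst sum.swap) (simp add: sum.cartesian_product)
  show "sq_norm (reflect w \<psi>) = sq_norm \<psi>"
    using sq_norm_eq_sum[OF fin, of \<psi>, OF supp] sq_norm_eq_sum[OF fin, of "reflect w \<psi>", OF supp']
    by (simp add: swap reflect_sum_cmod[OF W])
next
  fix \<psi> :: "'x \<times> 'y \<Rightarrow> complex"
  define W' where "W' = complex_of_real (\<Sum>x\<in>UNIV. (w x)\<^sup>2)"
  have W0: "W' \<noteq> 0" using W by (simp add: W'_def del: of_real_sum)
  have W2: "(\<Sum>x\<in>UNIV. complex_of_real (w x) * of_real (w x)) = W'"
    by (simp add: W'_def power2_eq_square)
  define c where "c y = (\<Sum>x\<in>UNIV. of_real (w x) * \<psi> (x, y))" for y
  have r: "reflect w \<psi> (x, y) = 2 * of_real (w x) * c y / W' - \<psi> (x, y)" for x y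
    by (simp add: reflect_def c_def W'_def)
  \<comment> \<open>The component along \<open>w\<close> is preserved, so both reflections subtract
    from the same vector, and subtracting twice returns \<psi>.\<close>
  have "(\<Sum>x\<in>UNIV. of_real (w x) * reflect w \<psi> (x, y)) = c y" for y
  proof -
    have "(\<Sum>x\<in>UNIV. of_real (w x) * reflect w \<psi> (x, y))
      = (\<Sum>x\<in>UNIV. (2 * c y / W') * (of_real (w x) * of_real (w x)) - of_real (w x) * \<psi> (x, y))"
      by (rule sum.cong) (auto simp: r algebra_simps)
    also have "\<dots> = (2 * c y / W') * W' - c y"
      unfolding sum_subtractf sum_distrib_left[symmetric] W2 c_def[symmetric] ..
    finally show ?thesis using W0 by simp
  qed
  then have "reflect w (reflect w \<psi>) (x, y) = 2 * of_real (w x) * c y / W' - reflect w \<psi> (x, y)" for x y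
    by (subst reflect_def) (simp add: W'_def)
  then show "reflect w (reflect w \<psi>) = \<psi>"
    by (auto simp: fun_eq_iff r)
next
  fix \<phi> \<psi> :: "'x \<times> 'y \<Rightarrow> complex" and a c :: complex
  have "(\<Sum>x\<in>UNIV. of_real (w x) * (a * \<phi> (x, y) + c * \<psi> (x, y)))
      = a * (\<Sum>x\<in>UNIV. of_real (w x) * \<phi> (x, y)) + c * (\<Sum>x\<in>UNIV. of_real (w x) * \<psi> (x, y))" for y
    unfolding sum_distrib_left sum.distrib[symmetric]
    by (rule sum.cong) (auto simp: algebra_simps)
  then show "reflect w (\<lambda>b. a * \<phi> b + c * \<psi> b) = (\<lambda>b. a * reflect w \<phi> b + c * reflect w \<psi> b)"
    by (auto simp: reflect_def fun_eq_iff algebra_simps add_divide_distrib)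
qed

section \<open>Execution of instruction lists\<close>

lemma measure_basis_ket: "measure_basis (ket b) = return_pmf b"
proof (rule pmf_eqI)
  fix i
  have eq: "(\<lambda>b'. (cmod (ket b b'))\<^sup>2) = indicator {b}"
    by (auto simp: ket_def fun_eq_iff indicator_def)
  have "pmf (measure_basis (ket b)) i = indicator {b} i"
    unfolding measure_basis_def eq
    by (rule pmf_embed_pmf) (simp_all add: ennreal_indicator)
  then show "pmf (measure_basis (ket b)) i = pmf (return_pmf b) i"
    by (simp add: pmf_return indicator_def)
qed

lemma query_op_ket: "query_op F (ket (x, y)) = ket (x, y + F x)"
  by (auto simp: query_op_def ket_def fun_eq_iff algebra_simps)

text \<open>Programs are indexed by absolute time; finite lists run from any configuration allow a
  trial or a round to be analysed independently of when it starts.\<close>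

primrec exec ::
  "('x \<Rightarrow> 'y::ab_group_add) \<Rightarrow> ('x, 'y) instr list \<Rightarrow> ('x, 'y) config \<Rightarrow> ('x, 'y) config pmf" where
  "exec F [] c = return_pmf c"
| "exec F (i # is) c = bind_pmf (step F i c) (exec F is)"

lemma exec_append: "exec F (is @ js) c = bind_pmf (exec F is c) (exec F js)"
  by (induction "is" arbitrary: c)
    (auto simp: bind_return_pmf bind_assoc_pmf intro!: bind_pmf_cong)

lemma exec_Halted [simp]: "exec F is (Halted x0 x1 q) = return_pmf (Halted x0 x1 q)"
  by (induction "is") (simp_all add: bind_return_pmf)

lemma exec_singleton: "exec F [i] = step F i"
  by (simp add: fun_eq_iff bind_return_pmf' exec.simps(1)[abs_def])

lemma run_add: "run A F (n + k) = bind_pmf (run A F n) (exec F (map (\<lambda>j. program A (n + j)) [0..<k]))"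
proof (induction k)
  case 0
  then show ?case by (simp add: bind_return_pmf' exec.simps(1)[abs_def])
next
  case (Suc k)
  then show ?case
    by (auto simp: bind_assoc_pmf exec_append exec_singleton intro!: bind_pmf_cong)
qed

lemma step_queries_mono: "c' \<in> set_pmf (step F i c) \<Longrightarrow> queries c \<le> queries c'"
  by (cases "(F, i, c)" rule: step.cases) (auto split: decision.splits)

text \<open>No step decreases the counter. Hence bounds at the ends of rounds suffice for the
  supremum over all times.\<close>

lemma expected_queries_mono:
  assumes "n \<le> n'"
  shows "(\<integral>\<^sup>+ c. of_nat (queries c) \<partial>measure_pmf (run A F n))
    \<le> (\<integral>\<^sup>+ c. of_nat (queries c) \<partial>measure_pmf (run A F n'))"
proof (rule lift_Suc_mono_le[OF _ assms])
  fix n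
  have "(\<integral>\<^sup>+ c. of_nat (queries c) \<partial>measure_pmf (run A F n))
    \<le> (\<integral>\<^sup>+ c. \<integral>\<^sup>+ c'. of_nat (queries c') \<partial>measure_pmf (step F (program A n) c) \<partial>measure_pmf (run A F n))"
  proof (rule nn_integral_mono)
    fix c
    have "of_nat (queries c) = (\<integral>\<^sup>+ c'. of_nat (queries c) \<partial>measure_pmf (step F (program A n) c))"
      by simp
    also have "\<dots> \<le> (\<integral>\<^sup>+ c'. of_nat (queries c') \<partial>measure_pmf (step F (program A n) c))"
      by (intro nn_integral_mono_AE AE_pmfI of_nat_mono step_queries_mono)
    finally show "of_nat (queries c) \<le> (\<integral>\<^sup>+ c'. of_nat (queries c') \<partial>measure_pmf (step F (program A n) c))" .
  qed
  then show "(\<integral>\<^sup>+ c. of_nat (queries c) \<partial>measure_pmf (run A F n))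
    \<le> (\<integral>\<^sup>+ c. of_nat (queries c) \<partial>measure_pmf (run A F (Suc n)))"
    by simp
qed

text \<open>Halted configurations are fixed by every step, so a lower bound reached at the end of a
  round persists at all later times.\<close>

lemma prob_halted_mono:
  fixes P :: "'x \<Rightarrow> 'x \<Rightarrow> bool"
  assumes "n \<le> n'"
  shows "measure_pmf.prob (run A F n) {Halted x0 x1 q | x0 x1 q. P x0 x1}
    \<le> measure_pmf.prob (run A F n') {Halted x0 x1 q | x0 x1 q. P x0 x1}"
proof (rule lift_Suc_mono_le[OF _ assms])
  fix n
  let ?D = "{Halted x0 x1 q | x0 x1 q. P x0 x1}"
  have "emeasure (run A F n) ?D = (\<integral>\<^sup>+ c. indicator ?D c \<partial>measure_pmf (run A F n))"
    by simp
  also have "\<dots> \<le> (\<integral>\<^sup>+ c. emeasure (step F (program A n) c) ?D \<partial>measure_pmf (run A F n))"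
    by (intro nn_integral_mono) (auto simp: indicator_def)
  also have "\<dots> = emeasure (run A F (Suc n)) ?D"
    by simp
  finally show "measure_pmf.prob (run A F n) ?D \<le> measure_pmf.prob (run A F (Suc n)) ?D"
    by (simp add: measure_pmf.emeasure_eq_measure)
qed


section \<open>Amplitude amplification\<close>

text \<open>
  Negating the value between the two queries makes the second one uncompute the first.
\<close>

definition grover_iteration :: "('x::finite, 'y::ab_group_add) instr list" where
  "grover_iteration =
     [Query, Apply flip_marked, Apply (\<lambda>_. negate_value), Query, Apply (\<lambda>_. reflect (\<lambda>_. 1))]"

text \<open>
  The sum of \<open>|x0\<rangle>\<close> and the uniform superposition: it bisects the angle between the two, so
  reflecting in it maps one to the other.
\<close>

definition to_uniform :: "'x::finite \<Rightarrow> 'x \<Rightarrow> real" where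
  "to_uniform x0 x = (if x = x0 then 1 else 0) + 1 / sqrt (card (UNIV :: 'x set))"

text \<open>Serves both phases: the fallback \<open>d\<close> enlarges the table in the first and
  keeps it in the second. The condition x' \<noteq> x prevents a table point from matching
  itself.\<close>

definition decide ::
  "('x, 'y) decision \<Rightarrow> ('x \<times> 'y) list \<Rightarrow> 'x \<times> 'y \<Rightarrow> ('x, 'y) decision" where
  "decide d L = (\<lambda>(x, y). if \<exists>x'. x' \<noteq> x \<and> (x', y) \<in> set L
     then Stop x (SOME x'. x' \<noteq> x \<and> (x', y) \<in> set L) else d)"

text \<open>The first reflection prepares the uniform superposition from |x0, 0>. Each iteration
  makes two queries, and a last query writes F x for the comparison with the table, which gives 3^k
  queries in all. A failed measurement restores |x0, 0> for the next trial.\<close>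

definition trial :: "'x::finite \<Rightarrow> nat \<Rightarrow> ('x, 'y::ab_group_add) instr list" where
  "trial x0 k = Apply (\<lambda>_. reflect (to_uniform x0)) #
     concat (replicate ((3 ^ k - 1) div 2) grover_iteration) @
     [Query, Measure (\<lambda>L. decide (Go L x0) L)]"

lemma decide_cases:
  obtains x' where "x' \<noteq> x" "(x', y) \<in> set L" "decide d L (x, y) = Stop x x'"
  | "\<And>x'. (x', y) \<in> set L \<Longrightarrow> x' = x" "decide d L (x, y) = d"
proof (cases "\<exists>x'. x' \<noteq> x \<and> (x', y) \<in> set L")
  case True
  then show thesis
    using that(1)[OF conjunct1 conjunct2, OF someI_ex someI_ex, OF True True]
    by (simp add: decide_def)
next
  case False
  then show thesis
    by (intro that(2)) (auto simp: decide_def)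
qed

lemma to_uniform_sq_sum:
  fixes x0 :: "'x::finite"
  shows "(\<Sum>x\<in>UNIV. (to_uniform x0 x)\<^sup>2) = 2 + 2 / sqrt (card (UNIV :: 'x set))"
proof -
  let ?N = "real (card (UNIV :: 'x set))"
  have N: "?N > 0" by (simp add: card_gt_0_iff)
  have "(\<Sum>x\<in>UNIV. (to_uniform x0 x)\<^sup>2)
    = (\<Sum>x\<in>UNIV. (if x = x0 then 1 + 2 / sqrt ?N else 0) + 1 / ?N)"
    by (rule sum.cong) (auto simp: to_uniform_def power2_eq_square field_simps)
  also have "\<dots> = 2 + 2 / sqrt ?N"
    using N by (simp add: sum.distrib)
  finally show ?thesis .
qed

lemma to_uniform_nonzero: "(\<Sum>x\<in>UNIV. (to_uniform x0 x)\<^sup>2) \<noteq> 0"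
  unfolding to_uniform_sq_sum
  by (smt (verit) divide_nonneg_nonneg of_nat_0_le_iff real_sqrt_ge_zero)

text \<open>With s = 1 / sqrt N, the inner product of \<open>to_uniform x0\<close> and the point
  mass at \<open>x0\<close> is 1 + s, half of the squared norm 2 (1 + s). The reflection therefore
  returns \<open>to_uniform x0\<close> minus the point mass, and this is uniform.\<close>

lemma reflect_to_uniform:
  fixes x0 :: "'x::finite"
  shows "reflect (to_uniform x0) (ket (x0, y0)) =
    (\<lambda>(x, y). if y = y0 then of_real (1 / sqrt (card (UNIV :: 'x set))) else 0)"
proof -
  let ?s = "1 / sqrt (card (UNIV :: 'x set))"
  have s: "1 + ?s > 0"
    by (smt (verit) divide_nonneg_nonneg of_nat_0_le_iff real_sqrt_ge_zero)
  have S: "(\<Sum>x\<in>UNIV. (to_uniform x0 x)\<^sup>2) = 2 * (1 + ?s)"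
    by (simp add: to_uniform_sq_sum)
  have c: "(\<Sum>x\<in>UNIV. of_real (to_uniform x0 x) * ket (x0, y0) (x, y)) =
    of_real (if y = y0 then 1 + ?s else 0)" for y
  proof -
    have "(\<Sum>x\<in>UNIV. of_real (to_uniform x0 x) * ket (x0, y0) (x, y))
      = (\<Sum>x\<in>UNIV. if x = x0 then complex_of_real (if y = y0 then 1 + ?s else 0) else 0)"
      by (rule sum.cong) (auto simp: to_uniform_def ket_def)
    then show ?thesis by simp
  qed
  have "reflect (to_uniform x0) (ket (x0, y0)) (x, y) =
      (if y = y0 then of_real ?s else 0)" for x y
  proof -
    have "2 * a * b / (2 * b) = a" if "b > 0" for a b :: real
      using that by simp
    from this[OF s] have "2 * to_uniform x0 x * (1 + ?s) / (2 * (1 + ?s)) = to_uniform x0 x" .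
    then have "complex_of_real (2 * to_uniform x0 x * (1 + ?s) / (2 * (1 + ?s))) = of_real (to_uniform x0 x)"
      by (rule arg_cong)
    then show ?thesis
      unfolding reflect_def S prod.case c
      by (cases "y = y0") (auto simp: ket_def to_uniform_def)
  qed
  then show ?thesis by (auto simp: fun_eq_iff)
qed

section \<open>Rotation of the search state for a table without collisions\<close>

locale search =
  fixes F :: "'x::finite \<Rightarrow> 'y::ab_group_add" and L :: "('x \<times> 'y) list" and \<theta> :: real
  assumes true_table: "(x, y) \<in> set L \<Longrightarrow> y = F x"
    and inj_table: "inj_on F (fst ` set L)"
    and angle: "0 < \<theta>" "\<theta> < pi / 2"
    and card_marked: "real (card {x. x \<notin> fst ` set L \<and> F x \<in> snd ` set L}) =
      card (UNIV :: 'x set) * (sin \<theta>)\<^sup>2"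
begin

definition marked :: "'x set" where
  "marked = {x. x \<notin> fst ` set L \<and> F x \<in> snd ` set L}"

text \<open>The unit vector at angle \<phi> in the plane spanned by the uniform superpositions of
  the marked and of the unmarked points, of which there are N sin^2 \<theta> and N cos^2 \<theta>.
  At \<phi> = \<theta> it is the uniform superposition of all points.\<close>

definition amplitude :: "real \<Rightarrow> 'x \<Rightarrow> real" where
  "amplitude \<phi> x = (if x \<in> marked then sin \<phi> / sin \<theta> else cos \<phi> / cos \<theta>) /
     sqrt (card (UNIV :: 'x set))"

definition searching :: "real \<Rightarrow> 'x \<times> 'y \<Rightarrow> complex" where
  "searching \<phi> = (\<lambda>(x, y). if y = 0 then of_real (amplitude \<phi> x) else 0)"

lemma sin_pos: "sin \<theta> > 0" and cos_pos: "cos \<theta> > 0"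
  using angle by (auto intro: sin_gt_zero cos_gt_zero)

lemma card_univ_pos: "real (card (UNIV :: 'x set)) > 0"
  by (simp add: card_gt_0_iff)

lemma sum_marked:
  fixes a b :: real
  shows "(\<Sum>x\<in>UNIV. if x \<in> marked then a else b) =
    card (UNIV :: 'x set) * ((sin \<theta>)\<^sup>2 * a + (cos \<theta>)\<^sup>2 * b)"
proof -
  have m: "real (card marked) = card (UNIV :: 'x set) * (sin \<theta>)\<^sup>2"
    using card_marked by (simp add: marked_def)
  have "real (card (- marked)) = card (UNIV :: 'x set) - real (card marked)"
    by (simp add: Compl_eq_Diff_UNIV card_Diff_subset card_mono of_nat_diff)
  also have "\<dots> = card (UNIV :: 'x set) * (cos \<theta>)\<^sup>2"
    by (simp add: m cos_squared_eq algebra_simps)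
  finally have "real (card (- marked)) = card (UNIV :: 'x set) * (cos \<theta>)\<^sup>2" .
  then show ?thesis
    by (simp add: sum.If_cases Compl_eq m algebra_simps)
qed

text \<open>Negating the marked amplitudes and inverting about the mean are two reflections of the
  plane described by \<open>amplitude\<close>; their composition is a rotation by 2
  \<theta>.\<close>

lemma amplitude_next:
  "2 * (\<Sum>x'\<in>UNIV. if x' \<in> marked then - amplitude \<phi> x' else amplitude \<phi> x') / card (UNIV :: 'x set)
     - (if x \<in> marked then - amplitude \<phi> x else amplitude \<phi> x) = amplitude (\<phi> + 2 * \<theta>) x"
proof -
  let ?N = "real (card (UNIV :: 'x set))"
  have "(\<Sum>x'\<in>UNIV. if x' \<in> marked then - amplitude \<phi> x' else amplitude \<phi> x')
    = (\<Sum>x'\<in>UNIV. if x' \<in> marked then - (sin \<phi> / sin \<theta> / sqrt ?N) else cos \<phi> / cos \<theta> / sqrt ?N)"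
    by (rule sum.cong) (auto simp: amplitude_def)
  \<comment> \<open>The weights sin^2 \<theta> and cos^2 \<theta> cancel the denominators and leave
    cos \<phi> cos \<theta> - sin \<phi> sin \<theta>.\<close>
  also have "\<dots> = ?N * (cos (\<phi> + \<theta>) / sqrt ?N)"
    unfolding sum_marked using sin_pos cos_pos card_univ_pos
    by (simp add: field_simps power2_eq_square cos_add)
  finally have mean: "(\<Sum>x'\<in>UNIV. if x' \<in> marked then - amplitude \<phi> x' else amplitude \<phi> x')
    = ?N * (cos (\<phi> + \<theta>) / sqrt ?N)" .
  have s: "sin (\<phi> + 2 * \<theta>) = 2 * cos (\<phi> + \<theta>) * sin \<theta> + sin \<phi>"
    unfolding sin_add cos_add sin_double cos_double_sin by (simp add: algebra_simps power2_eq_square)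
  have c: "cos (\<phi> + 2 * \<theta>) = 2 * cos (\<phi> + \<theta>) * cos \<theta> - cos \<phi>"
    unfolding sin_add cos_add sin_double cos_double_cos by (simp add: algebra_simps power2_eq_square)
  show ?thesis
    unfolding mean unfolding amplitude_def s c using sin_pos cos_pos card_univ_pos
    by (auto simp: field_simps)
qed

lemma grover_iteration_exec:
  "exec F (grover_iteration @ is) (Running L (searching \<phi>) q) =
   exec F is (Running L (searching (\<phi> + 2 * \<theta>)) (q + 2))"
proof -
  define \<psi> where "\<psi> = (\<lambda>(x, y::'y). if y = 0
    then complex_of_real (if x \<in> marked then - amplitude \<phi> x else amplitude \<phi> x) else 0)"
  have "query_op F (negate_value (flip_marked L (query_op F (searching \<phi>)))) = \<psi>"
    by (auto simp: fun_eq_iff \<psi>_def searching_def query_op_def negate_value_def flip_marked_def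
        marked_def)
  moreover have "reflect (\<lambda>_. 1) \<psi> = searching (\<phi> + 2 * \<theta>)"
  proof -
    have "reflect (\<lambda>_. 1) \<psi> (x, y) = searching (\<phi> + 2 * \<theta>) (x, y)" for x y
    proof (cases "y = 0")
      case True
      have "reflect (\<lambda>_. 1) \<psi> (x, y) = complex_of_real
        (2 * (\<Sum>x'\<in>UNIV. if x' \<in> marked then - amplitude \<phi> x' else amplitude \<phi> x') /
          card (UNIV :: 'x set) - (if x \<in> marked then - amplitude \<phi> x else amplitude \<phi> x))"
        using True by (simp add: reflect_def \<psi>_def)
      then show ?thesis
        unfolding amplitude_next using True by (simp add: searching_def)
    qed (simp add: reflect_def \<psi>_def searching_def)
    then show ?thesis by (auto simp: fun_eq_iff)
  qed
  ultimately show ?thesis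
    by (simp add: grover_iteration_def bind_return_pmf)
qed

lemma grover_iterations_exec:
  "exec F (concat (replicate j grover_iteration) @ is) (Running L (searching \<phi>) q) =
   exec F is (Running L (searching (\<phi> + 2 * real j * \<theta>)) (q + 2 * j))"
proof (induction j arbitrary: \<phi> q)
  case (Suc j)
  then show ?case
    by (simp add: grover_iteration_exec Suc algebra_simps)
qed simp

lemma measure_query_searching:
  "pmf (measure_basis (query_op F (searching \<phi>))) (x, y) = (if y = F x then (amplitude \<phi> x)\<^sup>2 else 0)"
proof -
  let ?N = "real (card (UNIV :: 'x set))"
  let ?f = "\<lambda>b. (cmod (query_op F (searching \<phi>) b))\<^sup>2"
  let ?A = "range (\<lambda>x. (x, F x))"
  have f: "?f (x, y) = (if y = F x then (amplitude \<phi> x)\<^sup>2 else 0)" for x y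
    by (simp add: query_op_def searching_def)
  \<comment> \<open>After the query the state is supported on the graph of \<open>F\<close>, which
    is finite. Total mass 1 is what \<open>embed_pmf\<close> requires.\<close>
  have "(\<integral>\<^sup>+b. ennreal (?f b) \<partial>count_space UNIV) = (\<Sum>b\<in>?A. ennreal (?f b))"
    by (rule nn_integral_count_space') (auto simp: query_op_def searching_def)
  also have "\<dots> = (\<Sum>x\<in>UNIV. ennreal ((amplitude \<phi> x)\<^sup>2))"
    by (subst sum.reindex) (auto simp: inj_on_def f)
  also have "\<dots> = ennreal (\<Sum>x\<in>UNIV. (amplitude \<phi> x)\<^sup>2)"
    by simp
  also have "(\<Sum>x\<in>UNIV. (amplitude \<phi> x)\<^sup>2) =
    (\<Sum>x\<in>UNIV. if x \<in> marked then (sin \<phi> / sin \<theta>)\<^sup>2 / ?N else (cos \<phi> / cos \<theta>)\<^sup>2 / ?N)"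
    by (rule sum.cong) (auto simp: amplitude_def power_divide)
  also have "\<dots> = (sin \<phi>)\<^sup>2 + (cos \<phi>)\<^sup>2"
    unfolding sum_marked using sin_pos cos_pos card_univ_pos
    by (simp add: field_simps)
  finally have "(\<integral>\<^sup>+b. ennreal (?f b) \<partial>count_space UNIV) = 1" by simp
  then show ?thesis
    unfolding measure_basis_def f[symmetric] by (intro pmf_embed_pmf) auto
qed

lemma prob_unmarked:
  "measure_pmf.prob (measure_basis (query_op F (searching \<phi>))) {(x, y). x \<notin> marked} = (cos \<phi>)\<^sup>2"
proof -
  let ?N = "real (card (UNIV :: 'x set))"
  let ?M = "measure_basis (query_op F (searching \<phi>))"
  let ?B = "(\<lambda>x. (x, F x)) ` (- marked)"
  have "set_pmf ?M \<inter> {(x, y). x \<notin> marked} \<subseteq> ?B"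
    by (auto simp: set_pmf_iff measure_query_searching image_iff split: if_splits)
  then have "measure_pmf.prob ?M {(x, y). x \<notin> marked} = measure_pmf.prob ?M ?B"
    by (intro measure_pmf.finite_measure_eq_AE AE_pmfI) auto
  also have "\<dots> = (\<Sum>b\<in>?B. pmf ?M b)"
    by (rule measure_measure_pmf_finite) simp
  also have "\<dots> = (\<Sum>x\<in>- marked. (amplitude \<phi> x)\<^sup>2)"
    by (subst sum.reindex) (auto simp: inj_on_def measure_query_searching)
  also have "\<dots> = (\<Sum>x\<in>UNIV. if x \<in> marked then 0 else (cos \<phi> / cos \<theta>)\<^sup>2 / ?N)"
    by (rule sum.mono_neutral_cong_left) (auto simp: amplitude_def power_divide power_mult_distrib)
  also have "\<dots> = (cos \<phi>)\<^sup>2"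
    unfolding sum_marked using cos_pos card_univ_pos by (simp add: field_simps)
  finally show ?thesis .
qed


section \<open>Failure probability of trials and rounds\<close>

definition finished :: "nat \<Rightarrow> ('x, 'y) config set" where
  "finished q = {Halted x0 x1 q' | x0 x1 q'. is_collision F x0 x1 \<and> q' \<le> q}"

definition ready :: "'x \<Rightarrow> nat \<Rightarrow> ('x, 'y) config" where
  "ready x0 q = Running L (ket (x0, 0)) q"

text \<open>Invariant between trials. The schedule is fixed and failures reset the register, so all
  unsuccessful branches merge into the one configuration \<open>ready x0 q\<close>, and \<delta>
  bounds the failure probability.\<close>

definition progress :: "'x \<Rightarrow> nat \<Rightarrow> real \<Rightarrow> ('x, 'y) config pmf \<Rightarrow> bool" where
  "progress x0 q \<delta> p \<longleftrightarrow> set_pmf p \<subseteq> insert (ready x0 q) (finished q) \<and> pmf p (ready x0 q) \<le> \<delta>"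

lemma finished_mono: "q \<le> q' \<Longrightarrow> finished q \<subseteq> finished q'"
  by (auto simp: finished_def)

lemma ready_notin_finished: "ready x0 q \<notin> finished q'"
  by (simp add: ready_def finished_def)

lemma exec_finished: "c \<in> finished q \<Longrightarrow> exec F is c = return_pmf c"
  by (auto simp: finished_def)

lemma trial_exec:
  "exec F (trial x0 k) (ready x0 q) =
   map_pmf (\<lambda>b. case decide (Go L x0) L b of
       Go L' x \<Rightarrow> Running L' (ket (x, 0)) (q + 3 ^ k) | Stop x0 x1 \<Rightarrow> Halted x0 x1 (q + 3 ^ k))
     (measure_basis (query_op F (searching (3 ^ k * \<theta>))))"
proof -
  define j where "j = ((3::nat) ^ k - 1) div 2"
  \<comment> \<open>Oddness makes the division in \<open>trial\<close> exact: j iterations take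
    \<theta> to (2 j + 1) \<theta> = 3^k \<theta>, and with the last query they cost 2 j + 1 = 3^k
    queries.\<close>
  have "odd ((3::nat) ^ k)" by simp
  then have j: "2 * j + 1 = 3 ^ k"
    unfolding j_def by presburger
  have "\<theta> + 2 * real j * \<theta> = real (2 * j + 1) * \<theta>"
    by (simp add: algebra_simps)
  then have a: "\<theta> + 2 * real j * \<theta> = 3 ^ k * \<theta>"
    unfolding j by simp
  have q: "Suc (q + 2 * j) = q + 3 ^ k"
    using j by simp
  have init: "reflect (to_uniform x0) (ket (x0, 0)) = searching \<theta>"
    using sin_pos cos_pos
    by (auto simp: reflect_to_uniform searching_def amplitude_def fun_eq_iff)
  show ?thesis
    unfolding trial_def ready_def j_def[symmetric]
    by (simp add: bind_return_pmf init grover_iterations_exec a q exec_singleton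
        bind_return_pmf' exec.simps(1)[abs_def])
qed

lemma progress_trial: "progress x0 (q + 3 ^ k) ((cos (3 ^ k * \<theta>))\<^sup>2) (exec F (trial x0 k) (ready x0 q))"
proof -
  let ?M = "measure_basis (query_op F (searching (3 ^ k * \<theta>)))"
  let ?g = "\<lambda>b. case decide (Go L x0) L b of
       Go L' x \<Rightarrow> Running L' (ket (x, 0)) (q + 3 ^ k) | Stop x0 x1 \<Rightarrow> Halted x0 x1 (q + 3 ^ k)"
  have supp: "snd b = F (fst b)" if "b \<in> set_pmf ?M" for b
    using that by (cases b) (auto simp: set_pmf_iff measure_query_searching split: if_splits)
  have "?g b \<in> insert (ready x0 (q + 3 ^ k)) (finished (q + 3 ^ k))" if b_supp: "b \<in> set_pmf ?M" for b
  proof -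
    obtain x where b: "b = (x, F x)" using supp[OF b_supp] by (metis prod.collapse)
    show ?thesis unfolding b
    proof (cases rule: decide_cases[where x = x and y = "F x" and L = L and d = "Go L x0"])
      case (1 x')
      then show "?g (x, F x) \<in> insert (ready x0 (q + 3 ^ k)) (finished (q + 3 ^ k))"
        using true_table[OF 1(2)] by (auto simp: finished_def is_collision_def)
    qed (simp add: ready_def)
  qed
  moreover have "pmf (map_pmf ?g ?M) (ready x0 (q + 3 ^ k)) \<le> (cos (3 ^ k * \<theta>))\<^sup>2"
  proof -
    \<comment> \<open>A measured marked point shares its value with a different table point, and
      then \<open>decide\<close> stops; failure thus requires an unmarked outcome.\<close>
    have "x \<notin> marked" if xy: "(x, y) \<in> set_pmf ?M" "?g (x, y) = ready x0 (q + 3 ^ k)" for x y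
    proof
      assume "x \<in> marked"
      then obtain x' where x': "(x', y) \<in> set L" "x' \<noteq> x"
        using supp[OF xy(1)] by (force simp: marked_def)
      show False
        by (rule decide_cases[where x = x and y = y and L = L and d = "Go L x0"])
          (use xy(2) x' in \<open>auto simp: ready_def\<close>)
    qed
    then have "measure_pmf.prob ?M (?g -` {ready x0 (q + 3 ^ k)}) \<le> measure_pmf.prob ?M {(x, y). x \<notin> marked}"
      by (intro measure_pmf.finite_measure_mono_AE AE_pmfI) auto
    then show ?thesis
      unfolding pmf_map prob_unmarked .
  qed
  ultimately show ?thesis
    unfolding progress_def trial_exec by auto
qed

text \<open>Halted configurations stay as they are and only \<open>ready x0 q\<close> goes on, so
  failure probabilities multiply.\<close>

lemma progress_bind:
  assumes p: "progress x0 q \<delta> p" and e: "progress x0 q' \<epsilon> (exec F is (ready x0 q))" and "q \<le> q'"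
  shows "progress x0 q' (\<delta> * \<epsilon>) (bind_pmf p (exec F is))"
proof -
  have p': "set_pmf p \<subseteq> insert (ready x0 q) (finished q)" "pmf p (ready x0 q) \<le> \<delta>"
    and e': "set_pmf (exec F is (ready x0 q)) \<subseteq> insert (ready x0 q') (finished q')"
      "pmf (exec F is (ready x0 q)) (ready x0 q') \<le> \<epsilon>"
    using p e by (auto simp: progress_def)
  have "set_pmf (exec F is c) \<subseteq> insert (ready x0 q') (finished q')" if "c \<in> set_pmf p" for c
  proof (cases "c = ready x0 q")
    case False
    then have "c \<in> finished q" using that p' by auto
    then show ?thesis using finished_mono[OF \<open>q \<le> q'\<close>] by (auto simp: exec_finished)
  qed (use e' in simp)
  moreover have "pmf (bind_pmf p (exec F is)) (ready x0 q')
      = pmf p (ready x0 q) * pmf (exec F is (ready x0 q)) (ready x0 q')"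
  proof -
    have "pmf (bind_pmf p (exec F is)) (ready x0 q')
      = (\<Sum>c\<in>{ready x0 q}. pmf p c *\<^sub>R pmf (exec F is c) (ready x0 q'))"
      unfolding pmf_bind
    proof (rule integral_measure_pmf)
      fix c assume c: "c \<in> set_pmf p" "pmf (exec F is c) (ready x0 q') \<noteq> 0"
      show "c \<in> {ready x0 q}"
      proof (rule ccontr)
        assume "c \<notin> {ready x0 q}"
        then have "c \<in> finished q" using c p' by auto
        then show False
          using c(2) by (auto simp: exec_finished pmf_return ready_notin_finished indicator_def split: if_splits)
      qed
    qed simp
    then show ?thesis by simp
  qed
  moreover have "pmf p (ready x0 q) * pmf (exec F is (ready x0 q)) (ready x0 q') \<le> \<delta> * \<epsilon>"
    using p' e' by (intro mult_mono) (auto intro: order_trans[OF pmf_nonneg])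
  ultimately show ?thesis
    unfolding progress_def by auto
qed

lemma progress_trials:
  "progress x0 (q + (\<Sum>k\<leftarrow>ks. 3 ^ k)) (\<Prod>k\<leftarrow>ks. (cos (3 ^ k * \<theta>))\<^sup>2)
     (exec F (concat (map (trial x0) ks)) (ready x0 q))"
proof (induction ks arbitrary: q)
  case Nil
  then show ?case by (simp add: progress_def)
next
  case (Cons k ks)
  have "progress x0 (q + 3 ^ k + (\<Sum>k\<leftarrow>ks. 3 ^ k))
      ((cos (3 ^ k * \<theta>))\<^sup>2 * (\<Prod>k\<leftarrow>ks. (cos (3 ^ k * \<theta>))\<^sup>2))
      (bind_pmf (exec F (trial x0 k) (ready x0 q)) (exec F (concat (map (trial x0) ks))))"
    by (rule progress_bind[OF progress_trial Cons.IH]) simp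
  then show ?case by (simp add: exec_append add.assoc)
qed

end

text \<open>The endpoints of [pi/4, 3 pi/4] have ratio 3, so an angle that starts below pi/2 and is
  repeatedly tripled cannot jump over this interval.\<close>

lemma exists_tripled_angle:
  fixes \<theta> :: real
  assumes "0 < \<theta>" "\<theta> < pi / 2" "pi / 4 \<le> 3 ^ K * \<theta>"
  shows "\<exists>k\<le>K. (cos (3 ^ k * \<theta>))\<^sup>2 \<le> 1 / 2"
proof -
  define k where "k = (LEAST k. pi / 4 \<le> 3 ^ k * \<theta>)"
  have k: "pi / 4 \<le> 3 ^ k * \<theta>" "k \<le> K"
    unfolding k_def by (rule LeastI[where P = "\<lambda>k. pi / 4 \<le> 3 ^ k * \<theta>"], fact) (rule Least_le, fact)
  have "3 ^ k * \<theta> \<le> 3 * pi / 4"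
  proof (cases k)
    case 0
    then show ?thesis using assms by simp
  next
    case (Suc k')
    then have "\<not> pi / 4 \<le> 3 ^ k' * \<theta>"
      unfolding k_def using not_less_Least[of k' "\<lambda>k. pi / 4 \<le> 3 ^ k * \<theta>"] by simp
    then have "3 ^ k' * \<theta> < pi / 4" by simp
    moreover have "3 ^ k * \<theta> = 3 * (3 ^ k' * \<theta>)" by (simp add: Suc)
    ultimately show ?thesis by linarith
  qed
  \<comment> \<open>The doubled angle is within pi/2 of pi, so its cosine is at most 0.\<close>
  then have "0 \<le> cos (2 * (3 ^ k * \<theta>) - pi)"
    using k by (intro cos_ge_zero) auto
  then have "cos (2 * (3 ^ k * \<theta>)) \<le> 0"
    by simp
  then have "(cos (3 ^ k * \<theta>))\<^sup>2 \<le> 1 / 2"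
    unfolding cos_double_cos by simp
  then show ?thesis using k by blast
qed

definition search_round :: "'x::finite \<Rightarrow> nat \<Rightarrow> ('x, 'y::ab_group_add) instr list" where
  "search_round x0 K = concat (map (trial x0) [0..<Suc K])"

lemma (in search) progress_round:
  assumes "pi / 4 \<le> 3 ^ K * \<theta>"
  shows "progress x0 (q + (\<Sum>k\<le>K. 3 ^ k)) (1 / 2) (exec F (search_round x0 K) (ready x0 q))"
proof -
  let ?f = "\<lambda>k. (cos (3 ^ k * \<theta>))\<^sup>2"
  obtain k where k: "k \<le> K" "?f k \<le> 1 / 2"
    using exists_tripled_angle[OF angle assms] by blast
  have "(\<Prod>k\<leftarrow>[0..<Suc K]. ?f k) = (\<Prod>k\<in>{..K}. ?f k)"
    using prod.distinct_set_conv_list[of "[0..<Suc K]" ?f]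
    by (simp add: atLeast0LessThan lessThan_Suc_atMost del: upt_Suc)
  \<comment> \<open>One good trial suffices: the other factors are squared cosines, hence at most
    1.\<close>
  also have "\<dots> = ?f k * (\<Prod>k\<in>{..K} - {k}. ?f k)"
    by (rule prod.remove) (use k in auto)
  also have "\<dots> \<le> 1 / 2 * 1"
    using k by (intro mult_mono prod_le_1 prod_nonneg) (auto simp: abs_square_le_1)
  finally have "(\<Prod>k\<leftarrow>[0..<Suc K]. ?f k) \<le> 1 / 2" by simp
  moreover have "(\<Sum>k\<leftarrow>[0..<Suc K]. (3::nat) ^ k) = (\<Sum>k\<le>K. 3 ^ k)"
    using sum.distinct_set_conv_list[of "[0..<Suc K]" "\<lambda>k. (3::nat) ^ k"]
    by (simp add: atLeast0LessThan lessThan_Suc_atMost del: upt_Suc)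
  ultimately show ?thesis
    using progress_trials[of x0 q "[0..<Suc K]"]
    by (auto simp: progress_def search_round_def simp del: upt_Suc)
qed


section \<open>Expected cost of repeated rounds\<close>

lemma concat_replicate_Suc: "concat (replicate (Suc n) xs) = concat (replicate n xs) @ xs"
  by (induction n) auto

text \<open>
  Queries so far plus \<open>2 Q\<close> if still running, with \<open>Q\<close> the cost of a round: a round adds \<open>Q\<close> and
  halves the probability of running, so the expectation does not increase.
\<close>

definition potential :: "nat \<Rightarrow> ('x, 'y) config \<Rightarrow> ennreal" where
  "potential Q c = (case c of Running _ _ q \<Rightarrow> of_nat (q + 2 * Q) | Halted _ _ q \<Rightarrow> of_nat q)"

lemma queries_le_potential: "of_nat (queries c) \<le> potential Q c"
  by (cases c) (auto simp: potential_def)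

text \<open>After the round at most q + Q queries have been made, and the surcharge 2 Q for still
  running has weight at most 1/2; together q + 2 Q, the potential before the round.\<close>

lemma (in search) progress_potential:
  assumes "progress x0 (q + Q) (1 / 2) p"
  shows "(\<integral>\<^sup>+c. potential Q c \<partial>measure_pmf p) \<le> of_nat (q + 2 * Q)"
proof -
  have "(\<integral>\<^sup>+c. potential Q c \<partial>measure_pmf p)
      \<le> (\<integral>\<^sup>+c. of_nat (q + Q) + of_nat (2 * Q) * indicator {ready x0 (q + Q)} c \<partial>measure_pmf p)"
  proof (intro nn_integral_mono_AE AE_pmfI)
    fix c assume "c \<in> set_pmf p"
    then consider "c = ready x0 (q + Q)" | "c \<in> finished (q + Q)"
      using assms by (auto simp: progress_def)
    then show "potential Q c \<le> of_nat (q + Q) + of_nat (2 * Q) * indicator {ready x0 (q + Q)} c"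
      by cases (auto simp: potential_def ready_def finished_def simp flip: of_nat_add of_nat_mult)
  qed
  also have "\<dots> = of_nat (q + Q) + of_nat (2 * Q) * ennreal (pmf p (ready x0 (q + Q)))"
    by (simp add: nn_integral_add nn_integral_cmult emeasure_pmf_single)
  also have "\<dots> \<le> of_nat (q + Q) + of_nat (2 * Q) * ennreal (1 / 2)"
    using assms by (intro add_left_mono mult_left_mono ennreal_leI) (auto simp: progress_def)
  also have "of_nat (2 * Q) * ennreal (1 / 2) = of_nat Q"
    unfolding ennreal_of_nat_eq_real_of_nat by (subst ennreal_mult[symmetric]) auto
  also have "of_nat (q + Q) + of_nat Q = (of_nat (q + 2 * Q) :: ennreal)"
    by (simp flip: of_nat_add)
  finally show ?thesis .
qed

text \<open>Both claims share one induction because the potential argument needs the support given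
  by \<open>progress\<close>: the potential of halted configurations stays the same, and that of the
  ready one does not grow on average.\<close>

lemma (in search) progress_rounds:
  fixes x0 :: 'x and q :: nat
  assumes angle_K: "pi / 4 \<le> 3 ^ K * \<theta>"
  defines "Q \<equiv> \<Sum>k\<le>K. 3 ^ k"
  defines "p \<equiv> \<lambda>c. exec F (concat (replicate c (search_round x0 K))) (ready x0 q)"
  shows "progress x0 (q + c * Q) ((1 / 2) ^ c) (p c)"
    and "(\<integral>\<^sup>+c. potential Q c \<partial>measure_pmf (p c)) \<le> of_nat (q + 2 * Q)"
proof (induction c)
  case 0
  show "progress x0 (q + 0 * Q) ((1 / 2) ^ 0) (p 0)"
    by (simp add: p_def progress_def pmf_le_1)
  show "(\<integral>\<^sup>+c. potential Q c \<partial>measure_pmf (p 0)) \<le> of_nat (q + 2 * Q)"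
    by (simp add: p_def potential_def ready_def)
next
  case (Suc c)
  have p_Suc: "p (Suc c) = bind_pmf (p c) (exec F (search_round x0 K))"
    by (simp add: p_def exec_append concat_replicate_Suc del: replicate_Suc)
  note round = progress_round[OF angle_K, folded Q_def]
  have "progress x0 (q + c * Q + Q) ((1 / 2) ^ c * (1 / 2)) (p (Suc c))"
    unfolding p_Suc by (rule progress_bind[OF Suc(1) round]) simp
  then show "progress x0 (q + Suc c * Q) ((1 / 2) ^ Suc c) (p (Suc c))"
    by (simp add: algebra_simps)
  have "(\<integral>\<^sup>+c. potential Q c \<partial>measure_pmf (p (Suc c)))
      = (\<integral>\<^sup>+d. \<integral>\<^sup>+c. potential Q c \<partial>measure_pmf (exec F (search_round x0 K) d) \<partial>measure_pmf (p c))"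
    unfolding p_Suc by simp
  also have "\<dots> \<le> (\<integral>\<^sup>+d. potential Q d \<partial>measure_pmf (p c))"
  proof (intro nn_integral_mono_AE AE_pmfI)
    fix d assume "d \<in> set_pmf (p c)"
    then consider "d = ready x0 (q + c * Q)" | "d \<in> finished (q + c * Q)"
      using Suc(1) by (auto simp: progress_def)
    then show "(\<integral>\<^sup>+c. potential Q c \<partial>measure_pmf (exec F (search_round x0 K) d)) \<le> potential Q d"
    proof cases
      case 1
      then show ?thesis
        using progress_potential[OF round, of x0 "q + c * Q"] by (simp add: potential_def ready_def)
    qed (simp add: exec_finished)
  qed
  finally show "(\<integral>\<^sup>+c. potential Q c \<partial>measure_pmf (p (Suc c))) \<le> of_nat (q + 2 * Q)"
    using Suc(2) by simp
qed

section \<open>The algorithm\<close>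

text \<open>In the first phase, step 2 i queries at |e i, 0> and step 2 i + 1 stores the outcome,
  compared with the older entries only. The last reset is to \<open>e m\<close>, which therefore is
  the base point of the search rounds; any point would serve, also when \<open>m\<close> is the size
  of the domain. The search round is then read cyclically.\<close>

definition collision_finder ::
  "(nat \<Rightarrow> 'x::finite) \<Rightarrow> nat \<Rightarrow> nat \<Rightarrow> ('x, 'y::ab_group_add) algorithm" where
  "collision_finder e m K = \<lparr>
     start = e 0,
     program = \<lambda>n.
       if n < 2 * m then
         if even n then Query else Measure (\<lambda>L b. decide (Go (b # L) (e (Suc (n div 2)))) L b)
       else search_round (e m) K ! ((n - 2 * m) mod length (search_round (e m) K :: ('x, 'y) instr list))\<rparr>"

lemma set_search_round:
  "set (search_round x0 K) \<subseteq> {Query, Apply flip_marked, Apply (\<lambda>_. negate_value),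
     Apply (\<lambda>_. reflect (\<lambda>_. 1)), Apply (\<lambda>_. reflect (to_uniform x0)),
     Measure (\<lambda>L. decide (Go L x0) L)}"
  by (auto simp: search_round_def trial_def grover_iteration_def simp del: upt_Suc)

lemma search_round_nonempty: "length (search_round x0 K) > 0"
  by (simp add: search_round_def trial_def)

lemma search_round_nth:
  "search_round x0 K ! (j mod length (search_round x0 K :: ('x::finite, 'y::ab_group_add) instr list))
     \<in> set (search_round x0 K :: ('x, 'y) instr list)"
  by (intro nth_mem mod_less_divisor search_round_nonempty)

lemma valid_collision_finder:
  "valid_algorithm (collision_finder e m K :: ('x::finite, 'y::ab_group_add) algorithm)"
  unfolding valid_algorithm_def
proof (intro allI impI)
  fix n and U :: "('x \<times> 'y) list \<Rightarrow> ('x \<times> 'y \<Rightarrow> complex) \<Rightarrow> ('x \<times> 'y \<Rightarrow> complex)" and L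
  assume U: "program (collision_finder e m K) n = Apply U"
  have "is_unitary (reflect (\<lambda>_. 1) :: ('x \<times> 'y \<Rightarrow> complex) \<Rightarrow> _)"
    by (rule is_unitary_reflect) simp
  moreover have "Apply U \<in> set (search_round (e m) K :: ('x, 'y) instr list)"
    using U search_round_nth[of "e m" K "n - 2 * m", where 'y = 'y]
    by (auto simp: collision_finder_def split: if_splits)
  then have "Apply U \<in> {Apply flip_marked, Apply (\<lambda>_. negate_value),
     Apply (\<lambda>_. reflect (\<lambda>_. 1)), Apply (\<lambda>_. reflect (to_uniform (e m)))}"
    using set_search_round[of "e m" K] by blast
  ultimately show "is_unitary (U L)"
    using is_unitary_flip_marked is_unitary_negate_value is_unitary_reflect[OF to_uniform_nonzero]
    by auto
qed

section \<open>Evolution of the table and the space bound\<close>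

text \<open>Only a measurement can set a table, and those of a search round either stop or keep the
  old one. The statement runs backwards in time, so that a reachable table is traced to the end of
  the first phase.\<close>

lemma step_search_round_table:
  assumes "i \<in> set (search_round x0 K)" and "Running L \<psi> q \<in> set_pmf (step F i c)"
  shows "\<exists>\<psi>' q'. c = Running L \<psi>' q'"
proof (cases c)
  case (Running L' \<psi>' q')
  consider "i = Query" | U where "i = Apply U" | "i = Measure (\<lambda>L. decide (Go L x0) L)"
    using assms(1) set_search_round[of x0 K] by blast
  then show ?thesis
    using assms(2) unfolding Running
    by cases (auto simp: decide_def split: decision.splits if_splits)
qed (use assms(2) in simp)

lemma exec_search_round_table:
  assumes "\<forall>i\<in>set is. i \<in> set (search_round x0 K)" and "Running L \<psi> q \<in> set_pmf (exec F is c)"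
  shows "\<exists>\<psi>' q'. c = Running L \<psi>' q'"
  using assms
proof (induction "is" arbitrary: c)
  case (Cons i "is")
  then obtain c' where c': "c' \<in> set_pmf (step F i c)" "Running L \<psi> q \<in> set_pmf (exec F is c')"
    by auto
  then obtain \<psi>' q' where "c' = Running L \<psi>' q'"
    using Cons by fastforce
  then have "Running L \<psi>' q' \<in> set_pmf (step F i c)" using c' by simp
  moreover have "i \<in> set (search_round x0 K)" using Cons.prems by simp
  ultimately show ?case by (rule step_search_round_table[rotated])
qed auto

lemma map_nth_mod: "map (\<lambda>j. xs ! (j mod length xs)) [0..<c * length xs] = concat (replicate c xs)"
proof (induction c)
  case (Suc c)
  have "map (\<lambda>j. xs ! (j mod length xs)) [c * length xs..<c * length xs + length xs] = xs"
    by (rule nth_equalityI) auto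
  then have "map (\<lambda>j. xs ! (j mod length xs)) [0..<c * length xs + length xs] = concat (replicate c xs) @ xs"
    using Suc by (simp add: upt_add_eq_append[of 0 "c * length xs"])
  then show ?case
    by (simp only: concat_replicate_Suc mult_Suc add.commute)
qed simp

lemma run_search_phase:
  fixes e :: "nat \<Rightarrow> 'x::finite" and F :: "'x \<Rightarrow> 'y::ab_group_add" and m K :: nat
  defines "A \<equiv> collision_finder e m K :: ('x, 'y) algorithm"
  defines "R \<equiv> search_round (e m) K :: ('x, 'y) instr list"
  shows "run A F (2 * m + k) = bind_pmf (run A F (2 * m)) (exec F (map (\<lambda>j. R ! (j mod length R)) [0..<k]))"
  unfolding run_add by (simp add: A_def R_def collision_finder_def)

text \<open>Reversed because new entries are put at the front.\<close>

definition table :: "('x \<Rightarrow> 'y) \<Rightarrow> (nat \<Rightarrow> 'x) \<Rightarrow> nat \<Rightarrow> ('x \<times> 'y) list" where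
  "table F e i = map (\<lambda>j. (e j, F (e j))) (rev [0..<i])"

lemma set_table: "set (table F e i) = (\<lambda>j. (e j, F (e j))) ` {..<i}"
  by (auto simp: table_def)

text \<open>Each measurement is of a basis state |e i, F (e i)>, so its outcome is certain and the
  run is a point mass throughout this phase.\<close>

lemma run_table_phase:
  fixes e :: "nat \<Rightarrow> 'x::finite" and F :: "'x \<Rightarrow> 'y::ab_group_add" and m K :: nat
  defines "A \<equiv> collision_finder e m K :: ('x, 'y) algorithm"
  assumes e: "inj_on e {..<m}" and "i \<le> m"
  obtains "run A F (2 * i) = return_pmf (Running (table F e i) (ket (e i, 0)) i)" "inj_on F (e ` {..<i})"
  | x0 x1 q where "run A F (2 * i) = return_pmf (Halted x0 x1 q)" "is_collision F x0 x1" "q \<le> i"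
proof -
  have "run A F (2 * i) = return_pmf (Running (table F e i) (ket (e i, 0)) i) \<and> inj_on F (e ` {..<i})
    \<or> (\<exists>x0 x1 q. run A F (2 * i) = return_pmf (Halted x0 x1 q) \<and> is_collision F x0 x1 \<and> q \<le> i)"
    using \<open>i \<le> m\<close>
  proof (induction i)
    case 0
    then show ?case by (simp add: table_def A_def collision_finder_def)
  next
    case (Suc i)
    then consider "run A F (2 * i) = return_pmf (Running (table F e i) (ket (e i, 0)) i)" "inj_on F (e ` {..<i})"
      | x0 x1 q where "run A F (2 * i) = return_pmf (Halted x0 x1 q)" "is_collision F x0 x1" "q \<le> i"
      by auto
    then show ?case
    proof cases
      case 1
      have prog: "program A (2 * i) = Query"
        "program A (Suc (2 * i)) = Measure (\<lambda>L b. decide (Go (b # L) (e (Suc i))) L b)"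
        using Suc.prems by (auto simp: A_def collision_finder_def)
      have run: "run A F (2 * Suc i) = return_pmf
          (case decide (Go ((e i, F (e i)) # table F e i) (e (Suc i))) (table F e i) (e i, F (e i)) of
             Go L' x \<Rightarrow> Running L' (ket (x, 0)) (Suc i) | Stop x0 x1 \<Rightarrow> Halted x0 x1 (Suc i))"
        by (simp add: 1 prog bind_return_pmf query_op_ket measure_basis_ket)
      show ?thesis
      proof (cases rule: decide_cases[where x = "e i" and y = "F (e i)" and L = "table F e i"
            and d = "Go ((e i, F (e i)) # table F e i) (e (Suc i))"])
        case (1 x')
        have "is_collision F (e i) x'"
          using 1 by (auto simp: set_table is_collision_def)
        then show ?thesis
          unfolding run 1(3) by auto
      next
        case 2
        have "F (e j) \<noteq> F (e i)" if "j < i" for j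
        proof
          assume "F (e j) = F (e i)"
          \<comment> \<open>In this case every table entry with value F (e i) belongs to
            \<open>e i\<close> itself, whereas \<open>e\<close> does not repeat points below
            \<open>m\<close>.\<close>
          then have "e j = e i" using 2(1)[of "e j"] that by (force simp: set_table)
          then show False
            using e that Suc.prems by (auto dest: inj_onD)
        qed
        then have "inj_on F (e ` {..<Suc i})"
          using 1(2) by (force simp: lessThan_Suc)
        moreover have "table F e (Suc i) = (e i, F (e i)) # table F e i"
          by (simp add: table_def)
        ultimately show ?thesis unfolding run 2(2) by simp
      qed
    next
      case 2
      then show ?thesis by (auto simp: bind_return_pmf)
    qed
  qed
  then show thesis using that by blast
qed

text \<open>For an arbitrary \<open>F\<close>, every reachable table consists of the evaluations at
  e 0, ..., e (i - 1) for some i \<le> m.\<close>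

lemma collision_finder_space:
  fixes e :: "nat \<Rightarrow> 'x::finite"
  assumes e: "inj_on e {..<m}" and "m \<le> S"
  shows "uses_space (collision_finder e m K :: ('x, 'y::ab_group_add) algorithm) S"
  unfolding uses_space_def
proof (intro allI impI)
  let ?A = "collision_finder e m K :: ('x, 'y) algorithm"
  fix F :: "'x \<Rightarrow> 'y" and n L \<psi> q
  assume L: "Running L \<psi> q \<in> set_pmf (run ?A F n)"
  have early: "\<exists>i\<le>m. L = table F e i" if "i \<le> m" "Running L \<psi> q \<in> set_pmf (run ?A F (2 * i))" for i \<psi> q
    using that by (cases rule: run_table_phase[OF e \<open>i \<le> m\<close>, where F = F and K = K]) auto
  have "\<exists>i\<le>m. L = table F e i"
  proof (cases "n < 2 * m")
    case True
    define i where "i = n div 2"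
    have i: "i < m" using True by (auto simp: i_def)
    consider "n = 2 * i" | "n = Suc (2 * i)" unfolding i_def by fastforce
    then show ?thesis
    proof cases
      case 1
      then show ?thesis using early[of i] L i by simp
    next
      case 2
      \<comment> \<open>At an odd time the latest instruction was a query, which leaves the table
        unchanged; the preceding even time decides.\<close>
      have "program ?A (2 * i) = Query" using i by (simp add: collision_finder_def)
      then obtain c where "c \<in> set_pmf (run ?A F (2 * i))" "Running L \<psi> q \<in> set_pmf (step F Query c)"
        using L 2 by auto
      then have "\<exists>\<psi> q. Running L \<psi> q \<in> set_pmf (run ?A F (2 * i))"
        by (cases c) auto
      then show ?thesis using early[of i] i by auto
    qed
  next
    case False
    let ?R = "search_round (e m) K :: ('x, 'y) instr list"
    obtain k where n: "n = 2 * m + k" using False by (metis le_add_diff_inverse not_less)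
    obtain c where c: "c \<in> set_pmf (run ?A F (2 * m))"
      "Running L \<psi> q \<in> set_pmf (exec F (map (\<lambda>j. ?R ! (j mod length ?R)) [0..<k]) c)"
      using L unfolding n run_search_phase by auto
    have "\<forall>i\<in>set (map (\<lambda>j. ?R ! (j mod length ?R)) [0..<k]). i \<in> set ?R"
      using search_round_nth by auto
    from exec_search_round_table[OF this c(2)] obtain \<psi>' q' where "c = Running L \<psi>' q'" by blast
    then show ?thesis using early[of m] c by blast
  qed
  then show "length L \<le> S \<and> (\<forall>(x, y)\<in>set L. y = F x)"
    using \<open>m \<le> S\<close> by (auto simp: set_table) (auto simp: table_def)
qed

section \<open>The search angle of an r-to-one function\<close>

lemma card_vimage_r_to_one:
  fixes F :: "'x::finite \<Rightarrow> 'y"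
  assumes "r_to_one r F" and "Y \<subseteq> range F"
  shows "card (F -` Y) = r * card Y"
proof -
  have "F -` Y = (\<Union>y\<in>Y. F -` {y})" by auto
  also have "card \<dots> = (\<Sum>y\<in>Y. card (F -` {y}))"
    using assms(2) by (intro card_UN_disjoint) (auto intro: finite_subset)
  also have "\<dots> = (\<Sum>y\<in>Y. r)"
    using assms by (intro sum.cong) (auto simp: r_to_one_def)
  finally show ?thesis by simp
qed


lemma search_angle:
  fixes F :: "'x::finite \<Rightarrow> 'y::ab_group_add" and e :: "nat \<Rightarrow> 'x"
  assumes e: "inj_on e {..<S}" and inj: "inj_on F (e ` {..<S})"
    and F: "r_to_one r F" "2 \<le> r" "card (range F) \<le> S * T\<^sup>2" and "1 \<le> S"
  obtains \<theta> where "search F (table F e S) \<theta>" "1 \<le> 2 * T * \<theta>"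
proof -
  define E M where "E = e ` {..<S}" and "M = card (range F)"
  define t where "t = (r - 1) * S"
  have cE: "card E = S"
    unfolding E_def using e by (simp add: card_image)
  have cFE: "card (F ` E) = S"
    using inj card_image[of F E] cE by (simp add: E_def)
  have SM: "S \<le> M"
    unfolding M_def cFE[symmetric] by (intro card_mono) auto
  have vimage_range: "F -` range F = UNIV" by auto
  have N: "card (UNIV :: 'x set) = r * M"
    using card_vimage_r_to_one[OF F(1) order_refl] by (simp add: M_def vimage_range)
  have tab: "fst ` set (table F e S) = E" "snd ` set (table F e S) = F ` E"
    by (auto simp: set_table E_def image_image)
  \<comment> \<open>The S distinct values have r S preimages, and S of these are the table
    points.\<close>
  have "{x. x \<notin> E \<and> F x \<in> F ` E} = F -` (F ` E) - E" by auto
  also have "card \<dots> = r * S - S"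
    using card_vimage_r_to_one[OF F(1) image_mono[OF subset_UNIV], of E]
    by (subst card_Diff_subset) (auto simp: cE cFE)
  also have "\<dots> = t" by (simp add: t_def algebra_simps)
  finally have t: "card {x. x \<notin> E \<and> F x \<in> F ` E} = t" .
  have "0 < t" using F(2) \<open>1 \<le> S\<close> by (simp add: t_def)
  \<comment> \<open>Strictness gives p < 1 and hence \<theta> < pi/2.\<close>
  have "t < r * M"
  proof -
    have "t < r * S" unfolding t_def using F(2) \<open>1 \<le> S\<close> by simp
    also have "\<dots> \<le> r * M" using SM by simp
    finally show ?thesis .
  qed
  define p where "p = real t / real (r * M)"
  have tM: "0 < real (r * M)" "real t < real (r * M)"
    using \<open>t < r * M\<close> by linarith+
  have p: "0 < p" "p < 1"
    unfolding p_def using \<open>0 < t\<close> tM by (simp_all only: zero_less_divide_iff divide_less_eq_1) auto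
  define \<theta> where "\<theta> = arcsin (sqrt p)"
  have sin: "sin \<theta> = sqrt p"
    unfolding \<theta>_def using p by (intro sin_arcsin) (auto intro: order_trans[of _ 0])
  have "0 < sqrt p" "sqrt p < 1" using p by auto
  moreover from this have "- 1 < sqrt p" by linarith
  ultimately have \<theta>: "0 < \<theta>" "\<theta> < pi / 2"
    unfolding \<theta>_def
    using arcsin_less_arcsin[of 0 "sqrt p"] arcsin_lt_bounded[of "sqrt p"] by simp_all
  have "search F (table F e S) \<theta>"
  proof
    show "y = F x" if "(x, y) \<in> set (table F e S)" for x y
      using that by (auto simp: set_table)
    show "inj_on F (fst ` set (table F e S))"
      using inj by (simp add: tab E_def)
    have "real t = real (r * M) * p"
      unfolding p_def using tM by (simp del: of_nat_mult)
    then show "real (card {x. x \<notin> fst ` set (table F e S) \<and> F x \<in> snd ` set (table F e S)}) =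
      card (UNIV :: 'x set) * (sin \<theta>)\<^sup>2"
      unfolding tab t sin N using p by simp
  qed (use \<theta> in auto)
  moreover have "1 \<le> 2 * T * \<theta>"
  proof -
    \<comment> \<open>Here r \<ge> 2 enters as r \<le> 2 (r - 1). The factor 2 is enlarged to 4
      below, so that the square root of the coefficient is 2 T.\<close>
    have "r * M \<le> 2 * (r - 1) * (S * T\<^sup>2)"
      using F(2,3) by (intro mult_le_mono) (auto simp: M_def)
    also have "\<dots> = 2 * t * T\<^sup>2" by (simp add: t_def)
    also have "\<dots> \<le> t * (2 * T)\<^sup>2" by (simp add: power_mult_distrib)
    finally have "real (r * M) \<le> real t * real ((2 * T)\<^sup>2)"
      by (simp only: of_nat_le_iff flip: of_nat_mult)
    then have "1 \<le> (2 * T)\<^sup>2 * p"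
      unfolding p_def using tM by (simp add: field_simps del: of_nat_mult)
    then have "1 \<le> sqrt ((2 * T)\<^sup>2 * p)" by simp
    also have "\<dots> = 2 * T * sin \<theta>" unfolding sin by (simp add: real_sqrt_mult)
    also have "\<dots> \<le> 2 * T * \<theta>"
      using \<theta> by (intro mult_left_mono sin_x_le_x) auto
    finally show ?thesis .
  qed
  ultimately show thesis using that by blast
qed

section \<open>Success probability and expected cost of the algorithm\<close>

text \<open>Bounds at the end of round c: the first tends to 1, and the second does not depend on
  c.\<close>

lemma collision_finder_rounds:
  fixes F :: "'x::finite \<Rightarrow> 'y::ab_group_add" and e :: "nat \<Rightarrow> 'x" and S T K c :: nat
  defines "m \<equiv> min S (card (UNIV :: 'x set))"
  defines "A \<equiv> collision_finder e m K :: ('x, 'y) algorithm"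
  defines "n \<equiv> 2 * m + c * length (search_round (e m) K :: ('x, 'y) instr list)"
  assumes e: "bij_betw e {..<card (UNIV :: 'x set)} UNIV" and "1 \<le> S" and K: "2 * T \<le> 3 ^ K"
    and F: "r_to_one r F" "2 \<le> r" "card (range F) \<le> S * T\<^sup>2"
  shows "1 - (1 / 2) ^ c \<le> measure_pmf.prob (run A F n) {Halted x0 x1 q | x0 x1 q. is_collision F x0 x1}"
    and "(\<integral>\<^sup>+ c. of_nat (queries c) \<partial>measure_pmf (run A F n)) \<le> of_nat (m + 2 * (\<Sum>k\<le>K. 3 ^ k))"
proof -
  let ?D = "{Halted x0 x1 q | x0 x1 q. is_collision F x0 x1}"
  let ?Q = "\<Sum>k\<le>K. 3 ^ k :: nat"
  have inj_e: "inj_on e {..<m}"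
    using e by (auto simp: m_def bij_betw_def intro: inj_on_subset)
  have run: "run A F n = bind_pmf (run A F (2 * m)) (exec F (concat (replicate c (search_round (e m) K))))"
    unfolding n_def A_def run_search_phase map_nth_mod ..
  have "1 - (1 / 2) ^ c \<le> measure_pmf.prob (run A F n) ?D \<and>
    (\<integral>\<^sup>+ c. of_nat (queries c) \<partial>measure_pmf (run A F n)) \<le> of_nat (m + 2 * ?Q)"
  proof (cases rule: run_table_phase[OF inj_e order_refl, where F = F and K = K, folded A_def])
    case 1
    \<comment> \<open>Otherwise the table holds the whole domain without a collision, which would
      make \<open>F\<close> injective, against r \<ge> 2.\<close>
    have "m = S"
    proof (rule ccontr)
      assume "m \<noteq> S"
      then have "inj F"
        using 1(2) e by (auto simp: m_def min_def bij_betw_def split: if_splits)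
      have "F -` {F (e 0)} = {e 0}" using \<open>inj F\<close> by (auto dest: injD)
      moreover have "card (F -` {F (e 0)}) = r" using F(1) by (simp add: r_to_one_def)
      ultimately show False using F(2) by simp
    qed
    have bounds: "card (range F) \<le> m * T\<^sup>2" "1 \<le> m"
      unfolding \<open>m = S\<close> using F(3) \<open>1 \<le> S\<close> by auto
    obtain \<theta> :: real where \<theta>: "search F (table F e m) \<theta>" "1 \<le> 2 * T * \<theta>"
      by (rule search_angle[OF inj_e 1(2) F(1,2) bounds])
    interpret search F "table F e m" \<theta> by fact
    \<comment> \<open>Since \<theta> \<ge> 1 / (2 T) and 3^K \<ge> 2 T, the largest tripled angle is
      at least 1, beyond pi/4.\<close>
    have "pi / 4 \<le> 1" using pi_less_4 by simp
    also have "1 \<le> real (2 * T) * \<theta>" using \<theta>(2) by simp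
    also have "\<dots> \<le> real (3 ^ K) * \<theta>"
      by (rule mult_right_mono[OF of_nat_mono[OF K] less_imp_le[OF angle(1)]])
    finally have "pi / 4 \<le> 3 ^ K * \<theta>" by simp
    note rounds = progress_rounds[OF this, where ?x0.0 = "e m" and q = m and c = c]
    have run': "run A F n = exec F (concat (replicate c (search_round (e m) K))) (ready (e m) m)"
      unfolding run 1(1) by (simp add: bind_return_pmf ready_def)
    have "set_pmf (run A F n) \<subseteq> insert (ready (e m) (m + c * ?Q)) ?D"
      using rounds(1) by (auto simp: run' progress_def finished_def)
    then have "1 = measure_pmf.prob (run A F n) (insert (ready (e m) (m + c * ?Q)) ?D)"
      by (intro sym[OF measure_pmf.prob_eq_1[THEN iffD2]]) (auto simp: AE_measure_pmf_iff)
    also have "\<dots> \<le> measure_pmf.prob (run A F n) {ready (e m) (m + c * ?Q)} + measure_pmf.prob (run A F n) ?D"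
      by (subst insert_is_Un) (rule measure_Un_le; simp)
    also have "measure_pmf.prob (run A F n) {ready (e m) (m + c * ?Q)} \<le> (1 / 2) ^ c"
      using rounds(1) by (simp add: run' progress_def measure_pmf_single)
    finally have "1 - (1 / 2) ^ c \<le> measure_pmf.prob (run A F n) ?D" by simp
    moreover have "(\<integral>\<^sup>+ c. of_nat (queries c) \<partial>measure_pmf (run A F n))
      \<le> (\<integral>\<^sup>+ c. potential ?Q c \<partial>measure_pmf (run A F n))"
      by (intro nn_integral_mono queries_le_potential)
    ultimately show ?thesis
      using rounds(2) unfolding run' by (meson order_trans)
  next
    case (2 x0 x1 q)
    \<comment> \<open>The first phase has already halted with a collision after at most m queries,
      and the rounds change nothing.\<close>
    then have "of_nat q \<le> (of_nat (m + 2 * ?Q) :: ennreal)" by (intro of_nat_mono) simp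
    then show ?thesis
      using 2 by (auto simp: run bind_return_pmf measure_return_pmf indicator_def)
  qed
  then show "1 - (1 / 2) ^ c \<le> measure_pmf.prob (run A F n) ?D"
    "(\<integral>\<^sup>+ c. of_nat (queries c) \<partial>measure_pmf (run A F n)) \<le> of_nat (m + 2 * ?Q)"
    by auto
qed

lemma power_three_bounds:
  assumes "1 \<le> T"
  obtains K where "2 * T \<le> 3 ^ K" "3 ^ K \<le> 6 * (T::nat)"
proof -
  have "\<exists>K. 2 * T \<le> 3 ^ K \<and> 3 ^ K \<le> 6 * T"
    using assms
  proof (induction T rule: nat_induct_at_least)
    case base
    show ?case by (rule exI[of _ 1]) simp
  next
    case (Suc T)
    then obtain K where K: "2 * T \<le> 3 ^ K" "3 ^ K \<le> 6 * T" by blast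
    show ?case
    proof (cases "2 * Suc T \<le> 3 ^ K")
      case True
      then show ?thesis using K by (intro exI[of _ K]) auto
    next
      case False
      \<comment> \<open>Now 2 T \<le> 3^K < 2 (T + 1), so the next power lies between 6 T \<ge> 2 (T
        + 1) and 6 (T + 1).\<close>
      then show ?thesis using K Suc.hyps by (intro exI[of _ "Suc K"]) auto
    qed
  qed
  then show thesis using that by blast
qed

theorem corollary3:
  fixes S T :: nat
  assumes "1 \<le> S" and "S \<le> T"
  shows "\<exists>A :: ('x::finite, 'y::ab_group_add) algorithm.
           valid_algorithm A \<and> uses_space A S \<and>
           (\<forall>(r::nat) (F :: 'x \<Rightarrow> 'y).
              2 \<le> r \<longrightarrow> r_to_one r F \<longrightarrow> card (range F) \<le> S * T\<^sup>2 \<longrightarrow>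
                finds_collision A F \<and> expected_queries A F \<le> of_nat (query_const * T))"
proof -
  obtain e :: "nat \<Rightarrow> 'x" where e: "bij_betw e {..<card (UNIV :: 'x set)} UNIV"
    using ex_bij_betw_nat_finite[of "UNIV :: 'x set"] by (auto simp: atLeast0LessThan)
  obtain K where K: "2 * T \<le> 3 ^ K" "3 ^ K \<le> 6 * T"
    using power_three_bounds[of T] assms by auto
  \<comment> \<open>The table cannot hold more distinct points than the domain has. The algorithm is
    built from the enumeration, \<open>S\<close> and \<open>T\<close> alone, before \<open>r\<close>
    and \<open>F\<close> are given.\<close>
  define m where "m = min S (card (UNIV :: 'x set))"
  define A :: "('x, 'y) algorithm" where "A = collision_finder e m K"
  define R where "R = length (search_round (e m) K :: ('x, 'y) instr list)"
  have "R > 0" unfolding R_def by (rule search_round_nonempty)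
  have inj_e: "inj_on e {..<m}"
    using e by (auto simp: m_def bij_betw_def intro: inj_on_subset)
  have Q: "m + 2 * (\<Sum>k\<le>K. 3 ^ k) \<le> query_const * T"
  proof -
    \<comment> \<open>Twice the cost of a round is below 3 * 6 T = 18 T, and m \<le> S \<le> T, so
      19 T queries suffice.\<close>
    have "2 * (\<Sum>k\<le>K. 3 ^ k) + 1 = (3::nat) ^ Suc K"
      by (induction K) auto
    then show ?thesis using K assms by (simp add: m_def query_const_def)
  qed
  have "finds_collision A F \<and> expected_queries A F \<le> of_nat (query_const * T)"
    if F: "r_to_one r F" "2 \<le> r" "card (range F) \<le> S * T\<^sup>2" for r and F :: "'x \<Rightarrow> 'y"
  proof
    note rounds = collision_finder_rounds[OF e \<open>1 \<le> S\<close> K(1) F, folded m_def, folded A_def R_def]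
    let ?p = "\<lambda>n. measure_pmf.prob (run A F n) {Halted x0 x1 q | x0 x1 q. is_collision F x0 x1}"
    show "finds_collision A F"
      unfolding finds_collision_def
    proof (rule order_tendstoI)
      fix a :: real assume "a < 1"
      have "(\<lambda>c. 1 - (1 / 2) ^ c :: real) \<longlonglongrightarrow> 1 - 0"
        by (intro tendsto_intros LIMSEQ_power_zero) simp
      then have "eventually (\<lambda>c. a < 1 - (1 / 2) ^ c) sequentially"
        using \<open>a < 1\<close> by (intro order_tendstoD) simp_all
      then obtain c where "a < 1 - (1 / 2) ^ c"
        by (auto simp: eventually_sequentially)
      then have "a < ?p (2 * m + c * R)" using rounds(1)[of c] by linarith
      then show "eventually (\<lambda>n. a < ?p n) sequentially"
        unfolding eventually_sequentially by (blast intro: less_le_trans prob_halted_mono)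
    next
      fix a :: real assume "1 < a"
      then show "eventually (\<lambda>n. ?p n < a) sequentially"
        by (intro always_eventually allI) (meson le_less_trans measure_pmf.prob_le_1)
    qed
    show "expected_queries A F \<le> of_nat (query_const * T)"
      unfolding expected_queries_def
    proof (rule SUP_least)
      fix n
      \<comment> \<open>A round has at least one instruction, so time n comes no later than the end
        of round n, where the uniform bound applies.\<close>
      have "n \<le> 2 * m + n * R" using \<open>R > 0\<close> by (cases R) auto
      then have "(\<integral>\<^sup>+ c. of_nat (queries c) \<partial>measure_pmf (run A F n))
          \<le> (\<integral>\<^sup>+ c. of_nat (queries c) \<partial>measure_pmf (run A F (2 * m + n * R)))"
        by (rule expected_queries_mono)
      also have "\<dots> \<le> of_nat (m + 2 * (\<Sum>k\<le>K. 3 ^ k))"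
        by (rule rounds)
      also have "\<dots> \<le> of_nat (query_const * T)"
        using Q by (rule of_nat_mono)
      finally show "(\<integral>\<^sup>+ c. of_nat (queries c) \<partial>measure_pmf (run A F n)) \<le> of_nat (query_const * T)" .
    qed
  qed
  moreover have "valid_algorithm A" unfolding A_def by (rule valid_collision_finder)
  moreover have "uses_space A S"
    unfolding A_def by (rule collision_finder_space[OF inj_e]) (simp add: m_def)
  ultimately show ?thesis by blast
qed

end
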